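(* Convergence speed of the fidelity with respect to the number of rounds of distillation. (a) For the earlier recurrence entanglement distillation algorithm of Bennett, Brassard, Popescu, Schumacher, Smolin and Wootters (1996), the fidelities of the kept qubit pairs in consecutive rounds satisfy $$F_k=\frac{F_{k-1}^2+\frac19(1-F_{k-1})^2}{F_{k-1}^2+\frac23F_{k-1}(1-F_{k-1})+\frac59(1-F_{k-1})^2},$$ and in this case, when $F_0>\frac12$, $$\lim_{k\to\infty}\frac{1-F_k}{1-F_{k-1}}=\frac23 .$$ (b) For the proposed algorithm (described in the context), the fidelities of the kept qubit pairs satisfy $$F_k=\frac{F_{k-1}^2}{F_{k-1}^2+(1-F_{k-1})^2},$$ and when $F_0>\frac12$, $$\lim_{k\to\infty}\frac{1-F_k}{1-F_{k-1}}=0,\qquad \lim_{k\to\infty}\frac{1-F_k}{(1-F_{k-1})^2}=1 .$$ Hence with the earlier algorithm the fidelity converges to $1$ linearly at rate $\frac23$, whereas with the proposed algorithm it converges to $1$ quadratically; the convergence speed is improved from linear to quadratic.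
   Context: A recurrence entanglement distillation algorithm acts in each round, by local operations and classical communication between two nodes A and B, on two shared qubit pairs in the same state. It tries to improve the entanglement of one pair (the source pair) at the expense of the other, which is discarded. $F_k$ denotes the fidelity $\langle\Phi^+|\rho_k|\Phi^+\rangle$ of the state $\rho_k$ of a pair kept after $k$ rounds, where $|\Phi^+\rangle=\frac1{\sqrt2}(|00\rangle+|11\rangle)$; $F_0$ is the fidelity before the first round. Proposed algorithm. The initial state of each pair is $$\rho=\tfrac12\big(|ab\rangle\langle ab|+e^{-i\alpha}R^{*}|ab\rangle\langle a'b'|+e^{i\alpha}R|a'b'\rangle\langle ab|+|a'b'\rangle\langle a'b'|\big),$$ where $\{|a\rangle,|a'\rangle\}$ and $\{|b\rangle,|b'\rangle\}$ are orthonormal bases of the qubits at A and B, $\alpha\in[0,2\pi)$, and $R$ is a complex number with $|R|\in[0,1]$. Let $\theta$ be $\alpha$ plus the phase of $R$, and $|\pm\rangle=\frac1{\sqrt2}(|0\rangle\pm|1\rangle)$. The nodes first apply the local unitaries $U_A=|+\rangle\langle a|+|-\rangle\langle a'|$ and $U_B=|+\rangle\langle b|+e^{-i\theta}|-\rangle\langle b'|$. This gives the state $F_0|\Phi^+\rangle\langle\Phi^+|+(1-F_0)|\Psi^+\rangle\langle\Psi^+|$ with $F_0=\frac12(1+|R|)$ and $|\Psi^+\rangle=\frac1{\sqrt2}(|01\rangle+|10\rangle)$. In every round, the nodes take two kept pairs. Each node applies a CNOT to its two qubits, with its qubit of the first (source) pair as control and its qubit of the second pair as target, and measures the target qubit in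 the basis $\{|0\rangle,|1\rangle\}$. The nodes compare outcomes; the source pair is kept if the outcomes agree and discarded otherwise. *)

theory Defs
  imports "HOL-Analysis.Analysis"
begin

text \<open>
  A qubit is a vector in \<open>complex ^ 2\<close>; the elements 0 and 1 of the index type \<open>2\<close> label the
  computational basis, and addition on that type is addition modulo 2 (XOR).  A pair shared by A
  and B is indexed by \<open>2 \<times> 2\<close>, with the bit of A first.  Two shared pairs are indexed by
  \<open>(2 \<times> 2) \<times> (2 \<times> 2)\<close>, with the source pair first.
\<close>

type_synonym 'n op = "complex ^ 'n ^ 'n"
type_synonym pair_op = "(2 \<times> 2) op"

section \<open>Linear algebra\<close>

definition ket :: "'n \<Rightarrow> complex ^ 'n"
  where "ket i = axis i 1"

text \<open>\<open>inner\<close> from the library is the real inner product, so the sesquilinear one is needed.\<close>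

definition cinner :: "complex ^ 'n \<Rightarrow> complex ^ 'n \<Rightarrow> complex"
  where "cinner v w = (\<Sum>i\<in>UNIV. cnj (v $ i) * w $ i)"

definition ketbra :: "complex ^ 'n \<Rightarrow> complex ^ 'n \<Rightarrow> 'n op"
  where "ketbra v w = (\<chi> i j. v $ i * cnj (w $ j))"

definition dagger :: "('n::finite) op \<Rightarrow> 'n op"
  where "dagger M = (\<chi> i j. cnj (M $ j $ i))"

definition kron_vec :: "complex ^ 'm \<Rightarrow> complex ^ 'n \<Rightarrow> complex ^ ('m \<times> 'n)"
    (infixr "\<otimes>\<^sub>v" 75)
  where "v \<otimes>\<^sub>v w = (\<chi> i. v $ fst i * w $ snd i)"

definition kron_op :: "('m::finite) op \<Rightarrow> ('n::finite) op \<Rightarrow> ('m \<times> 'n) op"  (infixr "\<otimes>\<^sub>o" 75)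
  where "M \<otimes>\<^sub>o N = (\<chi> i j. M $ fst i $ fst j * N $ snd i $ snd j)"

definition conj_by :: "('n::finite) op \<Rightarrow> 'n op \<Rightarrow> 'n op"
  where "conj_by U \<rho> = U ** \<rho> ** dagger U"

definition ptrace_snd :: "('m::finite \<times> 'n::finite) op \<Rightarrow> 'm op"
  where "ptrace_snd M = (\<chi> i j. \<Sum>k\<in>UNIV. M $ (i, k) $ (j, k))"

definition density_operator :: "('n::finite) op \<Rightarrow> bool"
  where "density_operator \<rho> \<longleftrightarrow>
    dagger \<rho> = \<rho> \<and> (\<forall>v. 0 \<le> Re (cinner v (\<rho> *v v))) \<and> trace \<rho> = 1"

definition qubit_basis :: "complex ^ 2 \<Rightarrow> complex ^ 2 \<Rightarrow> bool"
  where "qubit_basis v w \<longleftrightarrow> cinner v v = 1 \<and> cinner w w = 1 \<and> cinner v w = 0"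

definition phi_plus :: "complex ^ (2 \<times> 2)"
  where "phi_plus = (1 / sqrt 2) *\<^sub>R (ket 0 \<otimes>\<^sub>v ket 0 + ket 1 \<otimes>\<^sub>v ket 1)"

text \<open>For a Hermitian operator the quadratic form is real, so \<open>Re\<close> only changes the type.\<close>

definition fidelity :: "pair_op \<Rightarrow> real"
  where "fidelity \<rho> = Re (cinner phi_plus (\<rho> *v phi_plus))"


section \<open>Bilateral CNOT, measurement of the target pair, and post-selection\<close>

definition cnot :: pair_op
  where "cnot = (\<chi> i j. if i = (fst j, fst j + snd j) then 1 else 0)"

text \<open>
  Each node applies CNOT with its qubit of the source pair as control and its qubit of the target
  pair as target, so this is CNOT at A tensor CNOT at B, with the four qubits reordered.
\<close>

definition bilateral_cnot :: "((2 \<times> 2) \<times> (2 \<times> 2)) op"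
  where "bilateral_cnot = (\<chi> i j.
    case (i, j) of (((a1, b1), (a2, b2)), ((c1, d1), (c2, d2))) \<Rightarrow>
      cnot $ (a1, a2) $ (c1, c2) * cnot $ (b1, b2) $ (d1, d2))"

definition both_outcomes :: "2 \<Rightarrow> ((2 \<times> 2) \<times> (2 \<times> 2)) op"
  where "both_outcomes m = mat 1 \<otimes>\<^sub>o ketbra (ket m \<otimes>\<^sub>v ket m) (ket m \<otimes>\<^sub>v ket m)"

text \<open>The trace of the unnormalised state is the probability that the outcomes agree.\<close>

definition kept_unnormalised :: "pair_op \<Rightarrow> pair_op"
  where "kept_unnormalised \<rho> =
    ptrace_snd (\<Sum>m\<in>UNIV. conj_by (both_outcomes m) (conj_by bilateral_cnot (\<rho> \<otimes>\<^sub>o \<rho>)))"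

definition kept_state :: "pair_op \<Rightarrow> pair_op"
  where "kept_state \<rho> = (1 / Re (trace (kept_unnormalised \<rho>))) *\<^sub>R kept_unnormalised \<rho>"


section \<open>The algorithm of Bennett, Brassard, Popescu, Schumacher, Smolin and Wootters\<close>

text \<open>
  Writing \<open>q / norm q\<close> as a unit quaternion identifies the unit sphere of \<open>real ^ 4\<close> with SU(2).
  The direction of a uniformly distributed point of the unit ball is uniform on that sphere,
  so \<open>su2 q\<close> is then distributed according to the Haar probability measure of SU(2).
  The value at \<open>q = 0\<close> is irrelevant, since this point has measure zero.
\<close>

definition su2 :: "real ^ 4 \<Rightarrow> 2 op"
  where "su2 q = (1 / norm q) *\<^sub>R (\<chi> i j.
    if i = 0 then (if j = 0 then Complex (q $ 1) (q $ 2) else Complex (q $ 3) (q $ 4))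
    else (if j = 0 then Complex (- q $ 3) (q $ 4) else Complex (q $ 1) (- q $ 2)))"

text \<open>Random bilateral rotation: the same Haar-random element of SU(2) is applied at both nodes.\<close>

definition twirl :: "pair_op \<Rightarrow> pair_op"
  where "twirl \<rho> =
    (LINT q | uniform_measure lborel (ball 0 1). conj_by (su2 q \<otimes>\<^sub>o su2 q) \<rho>)"

definition sigma_y :: "2 op"
  where "sigma_y = ketbra (\<i> *s ket 1) (ket 0) - ketbra (\<i> *s ket 0) (ket 1)"

definition unilateral_sigma_y :: "pair_op \<Rightarrow> pair_op"
  where "unilateral_sigma_y \<rho> = conj_by (mat 1 \<otimes>\<^sub>o sigma_y) \<rho>"

text \<open>
  The unilateral \<open>sigma_y\<close> rotation exchanges \<open>phi_plus\<close> and the singlet, up to phases.  The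
  published protocol counts its rounds between the state in the singlet frame and ends a round by
  rotating the kept pair back to that frame.  Here the fidelity is taken with respect to
  \<open>phi_plus\<close>, so the same cycle of operations is cut right after the post-selection: rotate to
  the singlet frame, twirl, rotate back, then apply CNOT and measure.
\<close>

definition bbpssw_round :: "pair_op \<Rightarrow> pair_op"
  where "bbpssw_round \<rho> =
    kept_state (unilateral_sigma_y (twirl (unilateral_sigma_y \<rho>)))"

definition bbpssw_state :: "pair_op \<Rightarrow> nat \<Rightarrow> pair_op"
  where "bbpssw_state \<rho> k = (bbpssw_round ^^ k) \<rho>"


section \<open>The proposed algorithm\<close>

definition initial_state ::
    "complex ^ 2 \<Rightarrow> complex ^ 2 \<Rightarrow> complex ^ 2 \<Rightarrow> complex ^ 2 \<Rightarrow> real \<Rightarrow> complex \<Rightarrow> pair_op"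
  where "initial_state a a' b b' \<alpha> R = (1 / 2) *\<^sub>R
   (ketbra (a \<otimes>\<^sub>v b) (a \<otimes>\<^sub>v b)
    + ketbra ((exp (- \<i> * \<alpha>) * cnj R) *s (a \<otimes>\<^sub>v b)) (a' \<otimes>\<^sub>v b')
    + ketbra ((exp (\<i> * \<alpha>) * R) *s (a' \<otimes>\<^sub>v b')) (a \<otimes>\<^sub>v b)
    + ketbra (a' \<otimes>\<^sub>v b') (a' \<otimes>\<^sub>v b'))"

definition ket_plus :: "complex ^ 2"
  where "ket_plus = (1 / sqrt 2) *\<^sub>R (ket 0 + ket 1)"

definition ket_minus :: "complex ^ 2"
  where "ket_minus = (1 / sqrt 2) *\<^sub>R (ket 0 - ket 1)"

definition local_unitary_A :: "complex ^ 2 \<Rightarrow> complex ^ 2 \<Rightarrow> 2 op"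
  where "local_unitary_A a a' = ketbra ket_plus a + ketbra ket_minus a'"

definition local_unitary_B :: "complex ^ 2 \<Rightarrow> complex ^ 2 \<Rightarrow> real \<Rightarrow> 2 op"
  where "local_unitary_B b b' \<theta> =
    ketbra ket_plus b + ketbra (exp (- \<i> * \<theta>) *s ket_minus) b'"

text \<open>For \<open>R = 0\<close> the phase is arbitrary; the library's \<open>Arg 0 = 0\<close> is one choice.\<close>

definition proposed_state ::
    "complex ^ 2 \<Rightarrow> complex ^ 2 \<Rightarrow> complex ^ 2 \<Rightarrow> complex ^ 2 \<Rightarrow> real \<Rightarrow> complex \<Rightarrow> nat \<Rightarrow> pair_op"
  where "proposed_state a a' b b' \<alpha> R k = (kept_state ^^ k)
    (conj_by (local_unitary_A a a' \<otimes>\<^sub>o local_unitary_B b b' (\<alpha> + Arg R))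
      (initial_state a a' b b' \<alpha> R))"


section \<open>Orders of convergence\<close>

text \<open>The quotients are meaningful only if the sequence stays away from its limit.\<close>

definition converges_linearly :: "(nat \<Rightarrow> real) \<Rightarrow> real \<Rightarrow> real \<Rightarrow> bool"
  where "converges_linearly x L r \<longleftrightarrow>
    x \<longlonglongrightarrow> L \<and> (\<forall>\<^sub>F k in sequentially. x k \<noteq> L) \<and> 0 < r \<and> r < 1 \<and>
    (\<lambda>k. \<bar>x (Suc k) - L\<bar> / \<bar>x k - L\<bar>) \<longlonglongrightarrow> r"

definition converges_quadratically :: "(nat \<Rightarrow> real) \<Rightarrow> real \<Rightarrow> bool"
  where "converges_quadratically x L \<longleftrightarrow>
    x \<longlonglongrightarrow> L \<and> (\<forall>\<^sub>F k in sequentially. x k \<noteq> L) \<and>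
    (\<exists>c>0. (\<lambda>k. \<bar>x (Suc k) - L\<bar> / \<bar>x k - L\<bar>\<^sup>2) \<longlonglongrightarrow> c)"

end

theory Submission
  imports Defs
begin

text \<open>
  Let \<open>P\<close> and \<open>Q\<close> be the total populations of even and odd parity, and \<open>Z\<close> twice
  the real part of the coherence between the two even basis states; the fidelity is \<open>(P + Z) / 2\<close>.  Bilateral CNOT followed by
  post-selection on equal outcomes multiplies every entry by a sum of two entries, and the effect is
  \<open>(P, Z, Q) \<mapsto> (P\<^sup>2, Z\<^sup>2, Q\<^sup>2) / (P\<^sup>2 + Q\<^sup>2)\<close>.  In the proposed algorithm \<open>P = Z\<close> from the start,
  which gives its recurrence.  In the earlier algorithm the twirl keeps the singlet fraction \<open>F\<close>
  and spreads the rest evenly over the triplet, so that \<open>P = F + (1 - F) / 3\<close> and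
  \<open>Z = F - (1 - F) / 3\<close> before each CNOT.

  The evenness is a statement on second moments: \<open>U \<otimes> U\<close> rotates the triplet state of weight zero to
  a real unit vector (up to phases) that depends quadratically on the quaternion of \<open>U\<close>, the Hopf
  map, and orthogonal changes of variables on \<open>\<real>\<^sup>4\<close> show that its covariance is one third of the
  identity.

  Both recurrences strictly increase the fidelity on \<open>(1/2, 1)\<close> and have no fixed point there, so it
  tends to 1, and the quotients are continuous functions of it.
\<close>

section \<open>The post-selected CNOT\<close>

lemma UNIV_bit: "(UNIV :: 2 set) = {0, 1}"
  by (auto simp: UNIV_2)

lemma sum_bit: "(\<Sum>i\<in>(UNIV :: 2 set). f i) = f 0 + f 1"
  by (simp add: UNIV_bit)

lemma sum_two_bits: "(\<Sum>i\<in>(UNIV :: (2 \<times> 2) set). f i) = f (0, 0) + f (0, 1) + f (1, 0) + f (1, 1)"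
proof -
  have "(UNIV :: (2 \<times> 2) set) = {(0, 0), (0, 1), (1, 0), (1, 1)}"
    unfolding UNIV_Times_UNIV[symmetric] UNIV_bit by auto
  then have "sum f UNIV = sum f {(0, 0), (0, 1), (1, 0), (1, 1)}"
    by (rule arg_cong)
  then show ?thesis
    by (simp add: add.assoc)
qed

lemma bit_add_self [simp]: "(x :: 2) + x = 0" "(x :: 2) + (x + y) = y"
proof -
  show *: "(x :: 2) + x = 0" for x
    using exhaust_2[of x] by auto
  show "x + (x + y) = y"
    by (simp add: * flip: add.assoc)
qed

lemma conj_by_nth:
  "conj_by U \<rho> $ i $ j = (\<Sum>k\<in>UNIV. \<Sum>l\<in>UNIV. U $ i $ k * \<rho> $ k $ l * cnj (U $ j $ l))"
  unfolding conj_by_def dagger_def matrix_matrix_mult_def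
  by (simp add: sum_distrib_right sum_distrib_left) (rule sum.swap)

text \<open>Since this map is an involution, it serves both for the rows and for the columns of
  \<open>bilateral_cnot\<close>.\<close>

definition cnot_perm :: "(2 \<times> 2) \<times> (2 \<times> 2) \<Rightarrow> (2 \<times> 2) \<times> (2 \<times> 2)"
  where "cnot_perm = (\<lambda>((a1, b1), (a2, b2)). ((a1, b1), (a1 + a2, b1 + b2)))"

lemma bilateral_cnot_nth: "bilateral_cnot $ i $ j = (if j = cnot_perm i then 1 else 0)"
proof -
  obtain a1 b1 a2 b2 c1 d1 c2 d2 where ij: "i = ((a1, b1), (a2, b2))" "j = ((c1, d1), (c2, d2))"
    by (metis prod.exhaust)
  \<comment> \<open>\<open>cnot\<close> gives the row in terms of the column; being self-inverse, it
    can be solved for the column.\<close>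
  have *: "(a, a') = (c, c + c') \<longleftrightarrow> (c, c') = (a, a + a')" for a a' c c' :: 2
    by (metis bit_add_self(2) prod.inject)
  have "bilateral_cnot $ i $ j =
      (if (c1, c2) = (a1, a1 + a2) then 1 else 0) * (if (d1, d2) = (b1, b1 + b2) then 1 else 0)"
    unfolding bilateral_cnot_def cnot_def ij by (simp only: vec_lambda_beta prod.case fst_conv snd_conv *)
  then show ?thesis
    unfolding cnot_perm_def ij by auto
qed

lemma conj_by_bilateral_cnot_nth:
  "conj_by bilateral_cnot X $ i $ j = X $ cnot_perm i $ cnot_perm j"
proof -
  have *: "(if P then 1 else 0) * x = (if P then x else 0)"
    "x * cnj (if P then 1 else 0) = (if P then x else 0)" for P and x :: complex
    by auto
  show ?thesis
    by (simp add: conj_by_nth bilateral_cnot_nth *)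
qed

lemma both_outcomes_nth:
  "both_outcomes m $ i $ j = (if i = j \<and> snd i = (m, m) then 1 else 0)"
  by (auto simp: both_outcomes_def kron_op_def mat_def ketbra_def kron_vec_def ket_def axis_def
      prod_eq_iff)

lemma conj_by_both_outcomes_nth:
  "conj_by (both_outcomes m) X $ i $ j =
    (if snd i = (m, m) \<and> snd j = (m, m) then X $ i $ j else 0)"
proof -
  have *: "(if i = k \<and> P then 1 else 0) * x = (if k = i then if P then x else 0 else 0)"
    "x * cnj (if i = k \<and> P then 1 else 0) = (if k = i then if P then x else 0 else 0)"
    for P and x :: complex and i k :: "(2 \<times> 2) \<times> (2 \<times> 2)"
    by auto
  show ?thesis
    by (simp add: conj_by_nth both_outcomes_nth * cong: if_cong)
qed

text \<open>A target found in \<open>(m, m)\<close> held the source bits shifted by \<open>m\<close>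
  before the CNOT. The source entry is untouched, and tracing out the target leaves the sum over
  \<open>m\<close>.\<close>

lemma kept_unnormalised_nth:
  "kept_unnormalised \<rho> $ (a, b) $ (c, d) =
    \<rho> $ (a, b) $ (c, d) * (\<Sum>m\<in>UNIV. \<rho> $ (a + m, b + m) $ (c + m, d + m))"
proof -
  have "kept_unnormalised \<rho> $ (a, b) $ (c, d) =
    (\<Sum>k\<in>UNIV. \<Sum>m\<in>UNIV. if k = (m, m) then
        \<rho> $ (a, b) $ (c, d) * \<rho> $ (a + m, b + m) $ (c + m, d + m) else 0)"
    by (auto simp: kept_unnormalised_def ptrace_snd_def conj_by_both_outcomes_nth
      conj_by_bilateral_cnot_nth cnot_perm_def kron_op_def intro!: sum.cong)
  also have "\<dots> = (\<Sum>m\<in>UNIV. \<rho> $ (a, b) $ (c, d) * \<rho> $ (a + m, b + m) $ (c + m, d + m))"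
    by (subst sum.swap) simp
  finally show ?thesis
    by (simp add: sum_distrib_left)
qed

text \<open>The weights of the Bell states \<open>(|00\<rangle> \<plusminus> |11\<rangle>) / \<surd>2\<close> are \<open>(even_pop \<plusminus> even_coh) / 2\<close>.\<close>

definition even_pop :: "pair_op \<Rightarrow> complex"
  where "even_pop \<rho> = \<rho> $ (0, 0) $ (0, 0) + \<rho> $ (1, 1) $ (1, 1)"

definition even_coh :: "pair_op \<Rightarrow> complex"
  where "even_coh \<rho> = \<rho> $ (0, 0) $ (1, 1) + \<rho> $ (1, 1) $ (0, 0)"

definition odd_pop :: "pair_op \<Rightarrow> complex"
  where "odd_pop \<rho> = \<rho> $ (0, 1) $ (0, 1) + \<rho> $ (1, 0) $ (1, 0)"

lemma trace_pair: "trace \<rho> = even_pop \<rho> + odd_pop \<rho>"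
  by (simp add: trace_def sum_two_bits even_pop_def odd_pop_def)

lemma cinner_phi_plus: "cinner phi_plus (\<rho> *v phi_plus) = (even_pop \<rho> + even_coh \<rho>) / 2"
proof -
  have phi: "phi_plus $ (0, 0) = 1 / sqrt 2" "phi_plus $ (0, 1) = 0"
    "phi_plus $ (1, 0) = 0" "phi_plus $ (1, 1) = 1 / sqrt 2"
    by (simp_all add: phi_plus_def kron_vec_def ket_def axis_def vector_scaleR_component,
      simp_all add: scaleR_conv_of_real)
  have sq: "complex_of_real (sqrt 2) * complex_of_real (sqrt 2) = 2"
    by (simp flip: of_real_mult)
  show ?thesis
    unfolding cinner_def matrix_vector_mult_def
    by (simp add: sum_two_bits phi even_pop_def even_coh_def field_simps sq)
qed

lemma fidelity_eq: "fidelity \<rho> = Re (even_pop \<rho> + even_coh \<rho>) / 2"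
  by (simp add: fidelity_def cinner_phi_plus)

text \<open>The sum over \<open>m\<close> runs over an entry and its bit flip. It is thus the same
  for both entries of a component, and equal to that component.\<close>

lemma kept_unnormalised_components:
  "even_pop (kept_unnormalised \<rho>) = (even_pop \<rho>)\<^sup>2"
  "even_coh (kept_unnormalised \<rho>) = (even_coh \<rho>)\<^sup>2"
  "odd_pop (kept_unnormalised \<rho>) = (odd_pop \<rho>)\<^sup>2"
  by (simp_all add: even_pop_def even_coh_def odd_pop_def kept_unnormalised_nth sum_bit
      power2_eq_square algebra_simps)

text \<open>Real components ensure that the \<open>Re\<close> in the normalisation loses
  nothing.\<close>

lemma kept_state_components:
  assumes "even_pop \<rho> = of_real P" "even_coh \<rho> = of_real Z" "odd_pop \<rho> = of_real Q"
  shows "even_pop (kept_state \<rho>) = of_real (P\<^sup>2 / (P\<^sup>2 + Q\<^sup>2))"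
    "even_coh (kept_state \<rho>) = of_real (Z\<^sup>2 / (P\<^sup>2 + Q\<^sup>2))"
    "odd_pop (kept_state \<rho>) = of_real (Q\<^sup>2 / (P\<^sup>2 + Q\<^sup>2))"
proof -
  have N: "Re (trace (kept_unnormalised \<rho>)) = P\<^sup>2 + Q\<^sup>2"
    by (simp add: trace_pair kept_unnormalised_components assms flip: of_real_power)
  have lin: "even_pop (c *\<^sub>R X) = c *\<^sub>R even_pop X" "even_coh (c *\<^sub>R X) = c *\<^sub>R even_coh X"
    "odd_pop (c *\<^sub>R X) = c *\<^sub>R odd_pop X" for c X
    by (simp_all add: even_pop_def even_coh_def odd_pop_def scaleR_add_right)
  show "even_pop (kept_state \<rho>) = of_real (P\<^sup>2 / (P\<^sup>2 + Q\<^sup>2))"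
    "even_coh (kept_state \<rho>) = of_real (Z\<^sup>2 / (P\<^sup>2 + Q\<^sup>2))"
    "odd_pop (kept_state \<rho>) = of_real (Q\<^sup>2 / (P\<^sup>2 + Q\<^sup>2))"
    unfolding kept_state_def lin N kept_unnormalised_components assms
    by (simp_all add: scaleR_conv_of_real)
qed

section \<open>Convergence of the recurrences\<close>

text \<open>Monotone convergence gives a limit, continuity makes it a fixed point, and
  \<open>above\<close> leaves only 1.\<close>

lemma iterates_tendsto_one:
  fixes x :: "nat \<Rightarrow> real" and g :: "real \<Rightarrow> real"
  assumes step: "\<And>k. x (Suc k) = g (x k)"
    and x0: "1 / 2 < x 0" "x 0 < 1"
    and above: "\<And>y. 1 / 2 < y \<Longrightarrow> y < 1 \<Longrightarrow> y < g y"
    and below: "\<And>y. 1 / 2 < y \<Longrightarrow> y < 1 \<Longrightarrow> g y < 1"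
    and cont: "continuous_on {1 / 2<..} g"
  shows "x \<longlonglongrightarrow> 1" "\<And>k. 1 / 2 < x k" "\<And>k. x k < 1"
proof -
  have bnd: "1 / 2 < x k \<and> x k < 1" for k
  proof (induction k)
    case (Suc k)
    then show ?case
      using above[of "x k"] below[of "x k"] by (simp add: step)
  qed (use x0 in simp)
  then show "\<And>k. 1 / 2 < x k" "\<And>k. x k < 1"
    by auto
  have "incseq x"
    using bnd above step by (metis incseq_SucI less_imp_le)
  then obtain L where L: "x \<longlonglongrightarrow> L" "\<And>k. x k \<le> L"
    using bnd by (metis incseq_convergent less_imp_le)
  have "L \<le> 1"
    by (rule LIMSEQ_le_const2[OF L(1)]) (use bnd less_imp_le in blast)
  \<comment> \<open>The limit is at least \<open>x 0\<close>, so it stays inside the open ray where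
    \<open>g\<close> is continuous.\<close>
  with L(2)[of 0] bnd[of 0] have L1: "1 / 2 < L" "L \<le> 1"
    by auto
  have "isCont g L"
    using cont L1 by (simp add: continuous_on_eq_continuous_at)
  then have "(\<lambda>k. g (x k)) \<longlonglongrightarrow> g L"
    using L(1) by (rule isCont_tendsto_compose)
  moreover have "(\<lambda>k. g (x k)) \<longlonglongrightarrow> L"
    using L(1) by (simp add: LIMSEQ_Suc flip: step)
  ultimately have "g L = L"
    by (rule LIMSEQ_unique)
  then have "L = 1"
    using above[of L] L1 by fastforce
  then show "x \<longlonglongrightarrow> 1"
    using L by simp
qed

section \<open>The two recurrence maps and their error factors\<close>

definition bbpssw_map :: "real \<Rightarrow> real"
  where "bbpssw_map y = (y\<^sup>2 + 1 / 9 * (1 - y)\<^sup>2) /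
    (y\<^sup>2 + 2 / 3 * y * (1 - y) + 5 / 9 * (1 - y)\<^sup>2)"

definition proposed_map :: "real \<Rightarrow> real"
  where "proposed_map y = y\<^sup>2 / (y\<^sup>2 + (1 - y)\<^sup>2)"

text \<open>Completing the square in 8/9 y^2 - 4/9 y + 5/9.\<close>

lemma bbpssw_denominator_pos: "0 < y\<^sup>2 + 2 / 3 * y * (1 - y) + 5 / 9 * (1 - y)\<^sup>2" for y :: real
proof -
  have "y\<^sup>2 + 2 / 3 * y * (1 - y) + 5 / 9 * (1 - y)\<^sup>2 = 8 / 9 * (y - 1 / 4)\<^sup>2 + 1 / 2"
    by (simp add: power2_eq_square field_simps)
  then show ?thesis
    by (simp add: add_nonneg_pos)
qed

lemma proposed_denominator_pos: "0 < y\<^sup>2 + (1 - y)\<^sup>2" for y :: real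
  by (cases "y = 0") (auto simp: add_pos_nonneg)

text \<open>Splitting off 1 - y leaves the error quotient as a continuous cofactor; its value 2/3 at
  y = 1 is the linear rate.\<close>

lemma one_minus_bbpssw_map:
  "1 - bbpssw_map y =
    (1 - y) * ((2 / 3 * y + 4 / 9 * (1 - y)) / (y\<^sup>2 + 2 / 3 * y * (1 - y) + 5 / 9 * (1 - y)\<^sup>2))"
  using bbpssw_denominator_pos[of y]
  by (simp add: bbpssw_map_def divide_simps) (simp add: power2_eq_square algebra_simps)

text \<open>Here the error has a double zero at y = 1, and the cofactor has the value 1 there: this
  is quadratic convergence.\<close>

lemma one_minus_proposed_map: "1 - proposed_map y = (1 - y)\<^sup>2 * (1 / (y\<^sup>2 + (1 - y)\<^sup>2))"
  using proposed_denominator_pos[of y] by (simp add: proposed_map_def divide_simps)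

lemma bbpssw_iterates:
  assumes step: "\<And>k. x (Suc k) = bbpssw_map (x k)" and x0: "1 / 2 < x 0" "x 0 < 1"
  shows "(\<lambda>k. (1 - x (Suc k)) / (1 - x k)) \<longlonglongrightarrow> 2 / 3" "converges_linearly x 1 (2 / 3)"
proof -
  have bounds: "y < bbpssw_map y" "bbpssw_map y < 1" if y: "1 / 2 < y" "y < 1" for y
  proof -
    \<comment> \<open>One ninth of this product is the denominator minus the numerator of the error
      cofactor, so the cofactor is below 1.\<close>
    have "0 < (2 * y - 1) * (4 * y - 1)"
      using y by simp
    also have "\<dots> / 9 = (y\<^sup>2 + 2 / 3 * y * (1 - y) + 5 / 9 * (1 - y)\<^sup>2) - (2 / 3 * y + 4 / 9 * (1 - y))"
      by (simp add: power2_eq_square field_simps)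
    finally have "1 - bbpssw_map y < (1 - y) * 1"
      unfolding one_minus_bbpssw_map using y bbpssw_denominator_pos[of y]
      by (intro mult_strict_left_mono) (auto simp: divide_less_eq)
    then show "y < bbpssw_map y"
      by simp
    have "0 < 1 - bbpssw_map y"
      unfolding one_minus_bbpssw_map using y bbpssw_denominator_pos[of y]
      by (intro mult_pos_pos divide_pos_pos) (auto intro: add_pos_pos)
    then show "bbpssw_map y < 1"
      by simp
  qed
  have "continuous_on {1 / 2<..} bbpssw_map"
    unfolding bbpssw_map_def using bbpssw_denominator_pos
    by (intro continuous_intros) (auto simp: less_le)
  note lim = iterates_tendsto_one[OF step x0 bounds this]
  \<comment> \<open>Every iterate is strictly below 1, so the factor \<open>1 - x k\<close>
    cancels.\<close>
  have ratio: "(1 - x (Suc k)) / (1 - x k) = (2 / 3 * x k + 4 / 9 * (1 - x k)) /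
      ((x k)\<^sup>2 + 2 / 3 * x k * (1 - x k) + 5 / 9 * (1 - x k)\<^sup>2)" for k
    using lim(3)[of k] unfolding step one_minus_bbpssw_map by simp
  have "(\<lambda>k. (2 / 3 * x k + 4 / 9 * (1 - x k)) /
      ((x k)\<^sup>2 + 2 / 3 * x k * (1 - x k) + 5 / 9 * (1 - x k)\<^sup>2))
    \<longlonglongrightarrow> (2 / 3 * 1 + 4 / 9 * (1 - 1)) / (1\<^sup>2 + 2 / 3 * 1 * (1 - 1) + 5 / 9 * (1 - 1)\<^sup>2)"
    by (intro tendsto_intros lim) auto
  then show *: "(\<lambda>k. (1 - x (Suc k)) / (1 - x k)) \<longlonglongrightarrow> 2 / 3"
    unfolding ratio by simp
  have "\<bar>x (Suc k) - 1\<bar> / \<bar>x k - 1\<bar> = (1 - x (Suc k)) / (1 - x k)" for k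
    using lim(3)[of k] lim(3)[of "Suc k"] by simp
  then show "converges_linearly x 1 (2 / 3)"
    unfolding converges_linearly_def using lim * by (simp add: less_imp_neq)
qed

lemma proposed_iterates:
  assumes step: "\<And>k. x (Suc k) = proposed_map (x k)" and x0: "1 / 2 < x 0" "x 0 < 1"
  shows "(\<lambda>k. (1 - x (Suc k)) / (1 - x k)) \<longlonglongrightarrow> 0"
    "(\<lambda>k. (1 - x (Suc k)) / (1 - x k)\<^sup>2) \<longlonglongrightarrow> 1" "converges_quadratically x 1"
proof -
  have bounds: "y < proposed_map y" "proposed_map y < 1" if y: "1 / 2 < y" "y < 1" for y
  proof -
    \<comment> \<open>This product is y minus the denominator of
      \<open>proposed_map y\<close>.\<close>
    have "0 < (1 - y) * (2 * y - 1)"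
      using y by simp
    then have "y * (y\<^sup>2 + (1 - y)\<^sup>2) < y * y"
      using y by (intro mult_strict_left_mono) (auto simp: power2_eq_square algebra_simps)
    then show "y < proposed_map y"
      using proposed_denominator_pos[of y]
      by (simp add: proposed_map_def less_divide_eq power2_eq_square)
    show "proposed_map y < 1"
      using y proposed_denominator_pos[of y] by (simp add: proposed_map_def)
  qed
  have "continuous_on {1 / 2<..} proposed_map"
    unfolding proposed_map_def using proposed_denominator_pos
    by (intro continuous_intros) (auto simp: less_le)
  note lim = iterates_tendsto_one[OF step x0 bounds this]
  have ratio: "(1 - x (Suc k)) / (1 - x k)\<^sup>2 = 1 / ((x k)\<^sup>2 + (1 - x k)\<^sup>2)" for k
    using lim(3)[of k] unfolding step one_minus_proposed_map by simp
  have "(\<lambda>k. 1 / ((x k)\<^sup>2 + (1 - x k)\<^sup>2)) \<longlonglongrightarrow> 1 / (1\<^sup>2 + (1 - 1)\<^sup>2)"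
    by (intro tendsto_intros lim) auto
  then show *: "(\<lambda>k. (1 - x (Suc k)) / (1 - x k)\<^sup>2) \<longlonglongrightarrow> 1"
    unfolding ratio by simp
  \<comment> \<open>The first-order quotient is the error times the second-order quotient, and the
    error tends to 0.\<close>
  have "(\<lambda>k. (1 - x k) * ((1 - x (Suc k)) / (1 - x k)\<^sup>2)) \<longlonglongrightarrow> (1 - 1) * 1"
    by (intro tendsto_intros lim *)
  moreover have "(1 - x k) * ((1 - x (Suc k)) / (1 - x k)\<^sup>2) = (1 - x (Suc k)) / (1 - x k)" for k
    by (simp add: power2_eq_square)
  ultimately show "(\<lambda>k. (1 - x (Suc k)) / (1 - x k)) \<longlonglongrightarrow> 0"
    by simp
  have "\<bar>x (Suc k) - 1\<bar> / \<bar>x k - 1\<bar>\<^sup>2 = (1 - x (Suc k)) / (1 - x k)\<^sup>2" for k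
    using lim(3)[of "Suc k"] by (simp add: power2_commute)
  then show "converges_quadratically x 1"
    unfolding converges_quadratically_def using lim *
    by (auto simp: less_imp_neq intro!: exI[of _ 1])
qed

section \<open>The proposed algorithm\<close>

lemma conj_by_ketbra: "conj_by U (ketbra v w) = ketbra (U *v v) (U *v w)"
proof -
  have "conj_by U (ketbra v w) $ i $ j = ketbra (U *v v) (U *v w) $ i $ j" for i j
    by (simp add: conj_by_nth ketbra_def matrix_vector_mult_def sum_product mult_ac)
  then show ?thesis
    by (simp add: vec_eq_iff)
qed

lemma conj_by_add: "conj_by U (X + Y) = conj_by U X + conj_by U Y"
  by (simp add: vec_eq_iff conj_by_nth algebra_simps sum.distrib)

lemma conj_by_scaleR: "conj_by U (c *\<^sub>R X) = c *\<^sub>R conj_by U X"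
  by (simp add: vec_eq_iff conj_by_nth scaleR_sum_right)

lemma kron_mult_vec: "(M \<otimes>\<^sub>o N) *v (v \<otimes>\<^sub>v w) = (M *v v) \<otimes>\<^sub>v (N *v w)"
  unfolding kron_op_def kron_vec_def matrix_vector_mult_def
  by (simp add: vec_eq_iff sum_product mult_ac sum.cartesian_product split_def
      flip: UNIV_Times_UNIV)

lemma kron_vec_scale:
  "(c *s v) \<otimes>\<^sub>v w = c *s (v \<otimes>\<^sub>v w)" "v \<otimes>\<^sub>v (c *s w) = c *s (v \<otimes>\<^sub>v w)"
  by (simp_all add: vec_eq_iff kron_vec_def mult_ac)

lemma ketbra_mult_vec: "ketbra v w *v u = cinner w u *s v"
  by (simp add: vec_eq_iff ketbra_def matrix_vector_mult_def cinner_def sum_distrib_left sum_distrib_right mult_ac)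

lemma cinner_commute: "cinner v w = cnj (cinner w v)"
  by (simp add: cinner_def mult.commute)

lemma local_unitaries_mult_vec:
  assumes "qubit_basis a a'" "qubit_basis b b'"
  shows "local_unitary_A a a' *v a = ket_plus" "local_unitary_A a a' *v a' = ket_minus"
    "local_unitary_B b b' \<theta> *v b = ket_plus"
    "local_unitary_B b b' \<theta> *v b' = exp (- \<i> * \<theta>) *s ket_minus"
  \<comment> \<open>\<open>qubit_basis\<close> states orthogonality in one order only; conjugation
    supplies the other.\<close>
  using assms cinner_commute[of a' a] cinner_commute[of b' b]
  by (simp_all add: qubit_basis_def local_unitary_A_def local_unitary_B_def
      matrix_vector_mult_add_rdistrib ketbra_mult_vec)

text \<open>The phase that the unitary at B puts on \<open>b'\<close> cancels the phase of the
  coherence, leaving the real weight \<open>cmod R\<close> between the products of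
  \<open>ket_plus\<close> and of \<open>ket_minus\<close>.\<close>

lemma proposed_state_0_components:
  fixes R :: complex and \<alpha> :: real
  assumes "qubit_basis a a'" "qubit_basis b b'"
  defines "\<rho> \<equiv> proposed_state a a' b b' \<alpha> R 0"
  shows "even_pop \<rho> = of_real ((1 + cmod R) / 2)" "even_coh \<rho> = of_real ((1 + cmod R) / 2)"
    "odd_pop \<rho> = of_real ((1 - cmod R) / 2)"
proof -
  define \<theta> where "\<theta> = \<alpha> + Arg R"
  define z where "z = exp (- \<i> * \<theta>)"
  have z1: "z * cnj z = 1"
    unfolding z_def by (simp add: exp_cnj flip: exp_add)
  \<comment> \<open>Polar form of \<open>R\<close>: the coherence has phase \<theta>, opposite to
    that of \<open>z\<close>.\<close>
  have "cis \<alpha> * R = cmod R * cis \<theta>"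
    unfolding \<theta>_def by (subst (1) rcis_cmod_Arg[of R, symmetric]) (simp add: rcis_def cis_mult mult_ac)
  then have e: "exp (\<i> * \<alpha>) * R = cmod R * cnj z"
    by (simp add: cis_conv_exp z_def exp_cnj)
  then have "cnj (exp (\<i> * \<alpha>) * R) = cnj (cmod R * cnj z)"
    by simp
  then have e': "exp (- \<i> * \<alpha>) * cnj R = cmod R * z"
    by (simp add: exp_cnj)
  have "\<rho> = (1 / 2) *\<^sub>R
   (ketbra (ket_plus \<otimes>\<^sub>v ket_plus) (ket_plus \<otimes>\<^sub>v ket_plus)
    + ketbra ((cmod R * z) *s (ket_plus \<otimes>\<^sub>v ket_plus)) (z *s (ket_minus \<otimes>\<^sub>v ket_minus))
    + ketbra ((cmod R * cnj z) *s (z *s (ket_minus \<otimes>\<^sub>v ket_minus))) (ket_plus \<otimes>\<^sub>v ket_plus)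
    + ketbra (z *s (ket_minus \<otimes>\<^sub>v ket_minus)) (z *s (ket_minus \<otimes>\<^sub>v ket_minus)))"
    unfolding \<rho>_def proposed_state_def initial_state_def funpow_0 \<theta>_def[symmetric]
      conj_by_scaleR conj_by_add conj_by_ketbra e e'
    by (simp add: kron_mult_vec local_unitaries_mult_vec[OF assms(1,2)] kron_vec_scale
        vector_scalar_commute z_def)
  \<comment> \<open>The products \<open>z * cnj z\<close> stay grouped so that \<open>z1\<close> can
    remove them.\<close>
  then have entry: "\<rho> $ i $ j = (pp i * cnj (pp j) + cmod R * (z * cnj z) * pp i * cnj (mm j)
      + cmod R * (z * cnj z) * mm i * cnj (pp j) + (z * cnj z) * mm i * cnj (mm j)) / 2"
    if "pp = (\<lambda>i. (ket_plus \<otimes>\<^sub>v ket_plus) $ i)" "mm = (\<lambda>i. (ket_minus \<otimes>\<^sub>v ket_minus) $ i)"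
    for i j pp mm
    unfolding that ketbra_def by (simp add: vector_scaleR_component algebra_simps) (simp add: scaleR_conv_of_real field_simps)
  have sq: "complex_of_real (sqrt 2) * complex_of_real (sqrt 2) = 2"
    by (simp flip: of_real_mult)
  have "ket_plus $ x = 1 / sqrt 2" "ket_minus $ x = (if x = 0 then 1 else - 1) / sqrt 2" for x
    using exhaust_2[of x]
    by (auto simp: ket_plus_def ket_minus_def ket_def axis_def scaleR_conv_of_real[of _ "_ :: complex"])
  then have pm: "(ket_plus \<otimes>\<^sub>v ket_plus) $ i = 1 / 2"
    "(ket_minus \<otimes>\<^sub>v ket_minus) $ i = (if fst i = snd i then 1 / 2 else - 1 / 2)" for i
    using exhaust_2[of "fst i"] exhaust_2[of "snd i"] sq by (auto simp: kron_vec_def)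
  show "even_pop \<rho> = of_real ((1 + cmod R) / 2)" "even_coh \<rho> = of_real ((1 + cmod R) / 2)"
    "odd_pop \<rho> = of_real ((1 - cmod R) / 2)"
    unfolding even_pop_def even_coh_def odd_pop_def entry[OF refl refl] z1 pm by (simp_all add: field_simps)
qed

text \<open>The invariant of the rounds: unit trace, and no weight on the Bell state with a minus
  sign between \<open>|00>\<close> and \<open>|11>\<close>.\<close>

lemma proposed_components:
  assumes "qubit_basis a a'" "qubit_basis b b'"
  obtains F where "even_pop (proposed_state a a' b b' \<alpha> R k) = of_real F"
    "even_coh (proposed_state a a' b b' \<alpha> R k) = of_real F"
    "odd_pop (proposed_state a a' b b' \<alpha> R k) = of_real (1 - F)"
proof (induction k arbitrary: thesis)
  case 0
  show ?case
    by (rule 0[of "(1 + cmod R) / 2"]) (simp_all add: proposed_state_0_components[OF assms] field_simps)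
next
  case (Suc k)
  obtain F where F: "even_pop (proposed_state a a' b b' \<alpha> R k) = of_real F"
    "even_coh (proposed_state a a' b b' \<alpha> R k) = of_real F"
    "odd_pop (proposed_state a a' b b' \<alpha> R k) = of_real (1 - F)"
    using Suc.IH by blast
  have "1 - F\<^sup>2 / (F\<^sup>2 + (1 - F)\<^sup>2) = (1 - F)\<^sup>2 / (F\<^sup>2 + (1 - F)\<^sup>2)"
    using proposed_denominator_pos[of F] by (simp add: field_simps)
  with kept_state_components[OF F] show ?case
    by (intro Suc.prems[of "F\<^sup>2 / (F\<^sup>2 + (1 - F)\<^sup>2)"]) (simp_all add: proposed_state_def)
qed

lemma fidelity_proposed_Suc:
  assumes "qubit_basis a a'" "qubit_basis b b'"
  shows "fidelity (proposed_state a a' b b' \<alpha> R (Suc k)) =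
    proposed_map (fidelity (proposed_state a a' b b' \<alpha> R k))"
proof -
  obtain F where F: "even_pop (proposed_state a a' b b' \<alpha> R k) = of_real F"
    "even_coh (proposed_state a a' b b' \<alpha> R k) = of_real F"
    "odd_pop (proposed_state a a' b b' \<alpha> R k) = of_real (1 - F)"
    using proposed_components[OF assms] .
  have "proposed_state a a' b b' \<alpha> R (Suc k) = kept_state (proposed_state a a' b b' \<alpha> R k)"
    by (simp add: proposed_state_def)
  then have "even_pop (proposed_state a a' b b' \<alpha> R (Suc k)) = of_real (proposed_map F)"
    "even_coh (proposed_state a a' b b' \<alpha> R (Suc k)) = of_real (proposed_map F)"
    by (simp_all only: kept_state_components[OF F] proposed_map_def)
  then show ?thesis
    by (simp add: fidelity_eq F)
qed

section \<open>Averages over the sphere\<close>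

text \<open>Boxes determine \<open>lborel\<close>, and orthogonal maps preserve volumes.\<close>

lemma distr_lborel_orthogonal:
  fixes f :: "real ^ 'n::{finite,wellorder} \<Rightarrow> real ^ 'n::_"
  assumes f: "orthogonal_transformation f"
  shows "distr lborel borel f = lborel"
proof (rule lborel_eqI[symmetric])
  fix l u :: "real ^ 'n::_"
  assume le: "\<And>b. b \<in> Basis \<Longrightarrow> l \<bullet> b \<le> u \<bullet> b"
  have cont: "continuous_on UNIV f"
    using f by (intro linear_continuous_on) (simp add: linear_linear orthogonal_transformation_linear)
  have meas: "f \<in> borel \<rightarrow>\<^sub>M borel"
    using cont by (rule borel_measurable_continuous_onI)
  \<comment> \<open>The volume facts speak of images, so the preimage becomes an image under the
    inverse, which is orthogonal too.\<close>
  have inv: "f -` box l u = inv f ` box l u"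
    using f by (simp add: bij_vimage_eq_inv_image orthogonal_transformation_bij)
  have meas_eq: "measure lebesgue (f -` box l u) = measure lebesgue (box l u)"
    unfolding inv using f
    by (intro measure_orthogonal_image orthogonal_transformation_inv) auto
  have fin: "f -` box l u \<in> lmeasurable"
    unfolding inv using f
    by (intro measurable_orthogonal_image orthogonal_transformation_inv) auto
  have "f -` box l u \<in> sets borel"
    using measurable_sets[OF meas, of "box l u"] by simp
  then have "emeasure (distr lborel borel f) (box l u) = emeasure lebesgue (f -` box l u)"
    using meas by (simp add: emeasure_distr)
  also have "\<dots> = measure lebesgue (box l u)"
    using fin by (simp add: emeasure_eq_measure2 meas_eq)
  also have "\<dots> = (\<Prod>b\<in>Basis. (u - l) \<bullet> b)"
    using le by (simp add: measure_lborel_box_eq)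
  finally show "emeasure (distr lborel borel f) (box l u) = (\<Prod>b\<in>Basis. (u - l) \<bullet> b)" .
qed simp

section \<open>The uniform measure on the unit ball\<close>

definition ball_measure :: "(real ^ 'n::{finite,wellorder}) measure"
  where "ball_measure = uniform_measure lborel (ball 0 1)"

lemma emeasure_unit_ball: "emeasure lborel (ball (0 :: real ^ 'n::{finite,wellorder}) 1) \<noteq> 0"
    "emeasure lborel (ball (0 :: real ^ 'n::_) 1) < \<infinity>"
  using content_ball_pos[of 1 "0 :: real ^ 'n::_"] emeasure_lborel_ball_finite[of "0 :: real ^ 'n::_" 1]
  by (auto simp: measure_def)

lemma sets_ball_measure [simp, measurable_cong]: "sets ball_measure = sets borel"
  by (simp add: ball_measure_def)

lemma space_ball_measure [simp]: "space ball_measure = UNIV"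
  by (simp add: ball_measure_def)

lemma emeasure_ball_measure:
  fixes A :: "(real ^ 'n::{finite,wellorder}) set"
  shows "A \<in> sets borel \<Longrightarrow> emeasure ball_measure A =
    emeasure lborel (ball 0 1 \<inter> A) / emeasure lborel (ball (0 :: real ^ 'n::_) 1)"
  by (simp add: ball_measure_def)

lemma emeasure_ball_measure_UNIV: "emeasure ball_measure (UNIV :: (real ^ 'n::{finite,wellorder}) set) = 1"
  using emeasure_unit_ball[where 'n = 'n] by (simp add: emeasure_ball_measure ennreal_divide_self)

lemma finite_measure_ball_measure: "finite_measure ball_measure"
  by (rule finite_measureI) (simp add: emeasure_ball_measure_UNIV)

text \<open>Both Lebesgue measure and the unit ball are invariant under \<open>f\<close>.\<close>

lemma distr_ball_measure_orthogonal:
  fixes f :: "real ^ 'n::{finite,wellorder} \<Rightarrow> real ^ 'n::_"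
  assumes f: "orthogonal_transformation f"
  shows "distr ball_measure borel f = ball_measure"
proof (rule measure_eqI)
  fix A assume "A \<in> sets (distr ball_measure borel f)"
  then have A: "A \<in> sets borel"
    by simp
  have cont: "continuous_on UNIV f"
    using f by (intro linear_continuous_on) (simp add: linear_linear orthogonal_transformation_linear)
  then have meas: "f \<in> borel \<rightarrow>\<^sub>M borel"
    by (rule borel_measurable_continuous_onI)
  have vim: "f -` B \<in> sets borel" if "B \<in> sets borel" for B
    using measurable_sets[OF meas that] by simp
  have "ball 0 1 \<inter> f -` A = f -` (ball 0 1 \<inter> A)"
    using f by (auto simp: orthogonal_transformation_norm)
  then have "emeasure lborel (ball 0 1 \<inter> f -` A) = emeasure (distr lborel borel f) (ball 0 1 \<inter> A)"
    using A meas by (simp add: emeasure_distr)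
  then have "emeasure lborel (ball 0 1 \<inter> f -` A) = emeasure lborel (ball 0 1 \<inter> A)"
    by (simp only: distr_lborel_orthogonal[OF f])
  then show "emeasure (distr ball_measure borel f) A = emeasure ball_measure A"
    using A meas vim[OF A] by (simp add: emeasure_distr emeasure_ball_measure measurable_cong_sets[OF sets_ball_measure refl])
qed simp

text \<open>The rotation-invariant mean over the unit sphere, expressed through directions of points
  of the ball so that no surface measure has to be built.\<close>

definition sphere_mean :: "(real ^ 'n::{finite,wellorder} \<Rightarrow> 'a::euclidean_space) \<Rightarrow> 'a"
  where "sphere_mean G = (LINT q | ball_measure. G (sgn q))"

lemma measurable_comp_sgn:
  fixes G :: "real ^ 'n::{finite,wellorder} \<Rightarrow> 'a::euclidean_space"
  assumes "continuous_on UNIV G"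
  shows "(\<lambda>q. G (sgn q)) \<in> borel_measurable borel"
proof -
  have "(\<lambda>q :: real ^ 'n::_. inverse (norm q) *\<^sub>R q) \<in> borel_measurable borel"
    by measurable
  then have "sgn \<in> borel_measurable (borel :: (real ^ 'n::_) measure)"
    by (simp add: sgn_div_norm[abs_def])
  with borel_measurable_continuous_onI[OF assms] show ?thesis
    by (rule measurable_compose_rev)
qed

lemma integrable_comp_sgn:
  fixes G :: "real ^ 'n::{finite,wellorder} \<Rightarrow> 'a::euclidean_space"
  assumes "continuous_on UNIV G"
  shows "integrable ball_measure (\<lambda>q. G (sgn q))"
proof -
  \<comment> \<open>The closed ball replaces the sphere because \<open>sgn 0 = 0\<close>.\<close>
  have "compact (G ` cball 0 1)"
    using assms by (intro compact_continuous_image) (auto intro: continuous_on_subset)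
  then obtain B where B: "norm y \<le> B" if "y \<in> G ` cball 0 1" for y
    using compact_imp_bounded bounded_iff by metis
  have "sgn q \<in> cball 0 1" for q :: "real ^ 'n::_"
    by (simp add: norm_sgn)
  then have "norm (G (sgn q)) \<le> B" for q
    using B by blast
  then show ?thesis
    using measurable_comp_sgn[OF assms]
    by (intro finite_measure.integrable_const_bound[OF finite_measure_ball_measure, of _ B])
      (auto simp: measurable_cong_sets[OF sets_ball_measure refl])
qed

lemma sphere_mean_add:
  assumes "continuous_on UNIV G" "continuous_on UNIV H"
  shows "sphere_mean (\<lambda>p. G p + H p) = sphere_mean G + sphere_mean H"
  unfolding sphere_mean_def using assms by (intro Bochner_Integration.integral_add integrable_comp_sgn)

lemma sphere_mean_cmult:
  fixes G :: "real ^ 'n::{finite,wellorder} \<Rightarrow> complex"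
  shows "sphere_mean (\<lambda>p. c * G p) = c * sphere_mean G"
  unfolding sphere_mean_def by (rule integral_mult_right_zero)

text \<open>Reduces components of the twirled operator to means of scalar functions.\<close>

lemma sphere_mean_linear:
  assumes "linear L" "continuous_on UNIV G"
  shows "L (sphere_mean G) = sphere_mean (\<lambda>p. L (G p))"
  unfolding sphere_mean_def using assms
  by (intro integral_bounded_linear[symmetric] integrable_comp_sgn) (simp_all add: linear_linear)

text \<open>\<open>sgn q\<close> fails to be a unit vector only on the null set
  \<open>q = 0\<close>.\<close>

lemma sphere_mean_cong:
  fixes G H :: "real ^ 'n::{finite,wellorder} \<Rightarrow> 'a::euclidean_space"
  assumes "\<And>p. norm p = 1 \<Longrightarrow> G p = H p" "continuous_on UNIV G" "continuous_on UNIV H"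
  shows "sphere_mean G = sphere_mean H"
proof -
  have "AE q in lborel. q \<noteq> (0 :: real ^ 'n::_)"
    by (rule AE_lborel_singleton)
  then have "AE q in ball_measure. q \<noteq> (0 :: real ^ 'n::_)"
    unfolding ball_measure_def by (intro AE_uniform_measureI) auto
  then have "AE q in ball_measure. G (sgn q) = H (sgn q)"
    by eventually_elim (auto intro!: assms(1) simp: norm_sgn)
  then show ?thesis
    unfolding sphere_mean_def using assms(2,3)
    by (intro integral_cong_AE)
      (auto simp: measurable_cong_sets[OF sets_ball_measure refl] intro: measurable_comp_sgn)
qed

lemma sphere_mean_const: "sphere_mean (\<lambda>_. c) = c"
  by (simp add: sphere_mean_def measure_def emeasure_ball_measure_UNIV)

text \<open>Orthogonal maps commute with \<open>sgn\<close>, so this is a change of variables in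
  \<open>ball_measure\<close>.\<close>

lemma sphere_mean_orthogonal:
  fixes f :: "real ^ 'n::{finite,wellorder} \<Rightarrow> real ^ 'n::_" and G :: "real ^ 'n::_ \<Rightarrow> 'a::euclidean_space"
  assumes f: "orthogonal_transformation f" and G: "continuous_on UNIV G"
  shows "sphere_mean (\<lambda>p. G (f p)) = sphere_mean G"
proof -
  have cont: "continuous_on UNIV f"
    using f by (intro linear_continuous_on) (simp add: linear_linear orthogonal_transformation_linear)
  then have meas: "f \<in> ball_measure \<rightarrow>\<^sub>M borel"
    using borel_measurable_continuous_onI measurable_cong_sets[OF sets_ball_measure refl] by blast
  have "f (sgn q) = sgn (f q)" for q
    using f by (simp add: sgn_div_norm orthogonal_transformation_norm linear_scale
      orthogonal_transformation_linear)
  then have "sphere_mean (\<lambda>p. G (f p)) = (LINT q | distr ball_measure borel f. G (sgn q))"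
    unfolding sphere_mean_def using integral_distr[OF meas measurable_comp_sgn[OF G]] by simp
  then show ?thesis
    by (simp add: distr_ball_measure_orthogonal[OF f] sphere_mean_def)
qed

section \<open>Second moments of the Hopf map\<close>

definition upper :: "real ^ 4 \<Rightarrow> complex"
  where "upper p = Complex (p $ 1) (p $ 2)"

definition lower :: "real ^ 4 \<Rightarrow> complex"
  where "lower p = Complex (p $ 3) (p $ 4)"

text \<open>
  The three real coordinates of the Hopf map are the real and imaginary parts of \<open>hopf_u\<close>, and
  \<open>hopf_n\<close>, which is real but typed as complex.
\<close>

definition hopf_u :: "real ^ 4 \<Rightarrow> complex"
  where "hopf_u p = 2 * upper p * cnj (lower p)"

definition hopf_n :: "real ^ 4 \<Rightarrow> complex"
  where "hopf_n p = upper p * cnj (upper p) - lower p * cnj (lower p)"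

lemma continuous_upper_lower [continuous_intros]:
  "continuous_on S upper" "continuous_on S lower"
  unfolding upper_def lower_def by (auto simp: Complex_eq intro!: continuous_intros)

lemma continuous_hopf [continuous_intros]: "continuous_on S hopf_u" "continuous_on S hopf_n"
  unfolding hopf_u_def hopf_n_def by (auto intro!: continuous_intros)

lemma norm_upper_lower:
  "of_real ((norm p)\<^sup>2) = upper p * cnj (upper p) + lower p * cnj (lower p)"
  by (simp add: complex_mult_cnj upper_def lower_def power2_norm_eq_inner inner_vec_def sum_4
      flip: power2_eq_square)

text \<open>The identity 4st + (s - t)^2 = (s + t)^2 for the squared moduli s and t of
  \<open>upper p\<close> and \<open>lower p\<close>.\<close>

lemma hopf_norm:
  "hopf_u p * cnj (hopf_u p) + hopf_n p * hopf_n p = of_real ((norm p) ^ 4)"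
proof -
  have "of_real ((norm p) ^ 4) = (of_real ((norm p)\<^sup>2) :: complex)\<^sup>2"
    by (simp flip: power_mult)
  also have "\<dots> = hopf_u p * cnj (hopf_u p) + hopf_n p * hopf_n p"
    unfolding norm_upper_lower hopf_u_def hopf_n_def by (simp add: power2_eq_square algebra_simps)
  finally show ?thesis ..
qed

text \<open>Multiplication of \<open>lower\<close> by the imaginary unit, a quarter turn of the Hopf
  vector about the \<open>hopf_n\<close> axis.\<close>

definition phase_turn :: "real ^ 4 \<Rightarrow> real ^ 4"
  where "phase_turn p = vector [p $ 1, p $ 2, - p $ 4, p $ 3]"

text \<open>Turns the Hopf coordinate \<open>hopf_n\<close> into the real part of \<open>hopf_u\<close>.\<close>

definition mixing_turn :: "real ^ 4 \<Rightarrow> real ^ 4"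
  where "mixing_turn p = vector [(p $ 1 + p $ 3) / sqrt 2, (p $ 2 + p $ 4) / sqrt 2,
    (p $ 1 - p $ 3) / sqrt 2, (p $ 2 - p $ 4) / sqrt 2]"

lemma vector_4:
  "(vector [a, b, c, d] :: ('a::zero) ^ 4) $ 1 = a" "(vector [a, b, c, d] :: 'a ^ 4) $ 2 = b"
  "(vector [a, b, c, d] :: 'a ^ 4) $ 3 = c" "(vector [a, b, c, d] :: 'a ^ 4) $ 4 = d"
  unfolding vector_def by simp_all

lemma orthogonal_turns:
  "orthogonal_transformation phase_turn" "orthogonal_transformation mixing_turn"
proof -
  show "orthogonal_transformation phase_turn"
    unfolding orthogonal_transformation_def phase_turn_def
    by (auto intro!: linearI simp: vec_eq_iff forall_4 vector_4 inner_vec_def sum_4)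
  have *: "(a + c) * (a' + c') / 2 + (b + d) * (b' + d') / 2 + (a - c) * (a' - c') / 2
      + (b - d) * (b' - d') / 2 = a * a' + b * b' + c * c' + d * d'"
    for a b c d a' b' c' d' :: real
    by (simp add: field_simps)
  have "mixing_turn v \<bullet> mixing_turn w = v \<bullet> w" for v w
    by (simp add: mixing_turn_def inner_vec_def sum_4 vector_4 *)
  moreover have "linear mixing_turn"
    unfolding mixing_turn_def
    by (auto intro!: linearI simp: vec_eq_iff forall_4 vector_4 add_divide_distrib diff_divide_distrib
        algebra_simps)
  ultimately show "orthogonal_transformation mixing_turn"
    by (simp add: orthogonal_transformation_def)
qed

lemma hopf_phase_turn: "hopf_u (phase_turn p) = - \<i> * hopf_u p" "hopf_n (phase_turn p) = hopf_n p"
proof -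
  have "upper (phase_turn p) = upper p" "lower (phase_turn p) = \<i> * lower p"
    by (simp_all add: upper_def lower_def phase_turn_def vector_4 complex_eq_iff)
  then show "hopf_u (phase_turn p) = - \<i> * hopf_u p" "hopf_n (phase_turn p) = hopf_n p"
    by (simp_all add: hopf_u_def hopf_n_def algebra_simps)
qed

text \<open>Polarisation: |v + w|^2 - |v - w|^2 is four times the real part of v times the conjugate
  of w.\<close>

lemma hopf_mixing_turn: "hopf_n (mixing_turn p) = (hopf_u p + cnj (hopf_u p)) / 2"
proof -
  have sq: "complex_of_real (sqrt 2) * complex_of_real (sqrt 2) = 2"
    by (simp flip: of_real_mult)
  have "upper (mixing_turn p) = (upper p + lower p) / sqrt 2"
    "lower (mixing_turn p) = (upper p - lower p) / sqrt 2"
    by (simp_all add: upper_def lower_def mixing_turn_def vector_4 complex_eq_iff)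
  then have "upper (mixing_turn p) * cnj (upper (mixing_turn p)) =
      (upper p + lower p) * cnj (upper p + lower p) / 2"
    "lower (mixing_turn p) * cnj (lower (mixing_turn p)) =
      (upper p - lower p) * cnj (upper p - lower p) / 2"
    by (simp_all add: sq)
  then show ?thesis
    by (simp add: hopf_u_def hopf_n_def field_simps)
qed

text \<open>The phase turn kills the first four means. The mixing turn makes the last one half of
  the fifth, and \<open>hopf_norm\<close> makes these two add up to 1.\<close>

lemma hopf_moments:
  "sphere_mean (\<lambda>p. hopf_u p * hopf_u p) = 0"
  "sphere_mean (\<lambda>p. cnj (hopf_u p) * cnj (hopf_u p)) = 0"
  "sphere_mean (\<lambda>p. hopf_u p * hopf_n p) = 0"
  "sphere_mean (\<lambda>p. cnj (hopf_u p) * hopf_n p) = 0"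
  "sphere_mean (\<lambda>p. hopf_u p * cnj (hopf_u p)) = 2 / 3"
  "sphere_mean (\<lambda>p. hopf_n p * hopf_n p) = 1 / 3"
proof -
  \<comment> \<open>By invariance the mean equals \<open>c\<close> times itself, with
    \<open>c\<close> different from 1.\<close>
  have turn: "sphere_mean G = 0"
    if "continuous_on UNIV G" "\<And>p. G (phase_turn p) = c * G p" "c \<noteq> 1" for c :: complex and G
    using sphere_mean_orthogonal[OF orthogonal_turns(1) that(1)] that(2,3)
    by (simp add: sphere_mean_cmult)
  show u2: "sphere_mean (\<lambda>p. hopf_u p * hopf_u p) = 0"
    by (rule turn[of _ "-1"]) (auto intro!: continuous_intros simp: hopf_phase_turn algebra_simps)
  show u2': "sphere_mean (\<lambda>p. cnj (hopf_u p) * cnj (hopf_u p)) = 0"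
    by (rule turn[of _ "-1"]) (auto intro!: continuous_intros simp: hopf_phase_turn algebra_simps)
  show "sphere_mean (\<lambda>p. hopf_u p * hopf_n p) = 0"
    by (rule turn[of _ "-\<i>"]) (auto intro!: continuous_intros simp: hopf_phase_turn complex_eq_iff)
  show "sphere_mean (\<lambda>p. cnj (hopf_u p) * hopf_n p) = 0"
    by (rule turn[of _ "\<i>"]) (auto intro!: continuous_intros simp: hopf_phase_turn complex_eq_iff)
  let ?uu = "sphere_mean (\<lambda>p. hopf_u p * cnj (hopf_u p))"
  let ?nn = "sphere_mean (\<lambda>p. hopf_n p * hopf_n p)"
  have "?nn = sphere_mean (\<lambda>p. hopf_n (mixing_turn p) * hopf_n (mixing_turn p))"
    by (rule sphere_mean_orthogonal[OF orthogonal_turns(2), symmetric]) (intro continuous_intros)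
  also have "\<dots> = sphere_mean (\<lambda>p. 1 / 4 * (hopf_u p * hopf_u p)
      + (1 / 4 * (cnj (hopf_u p) * cnj (hopf_u p)) + 1 / 2 * (hopf_u p * cnj (hopf_u p))))"
    by (simp add: hopf_mixing_turn field_simps)
  also have "\<dots> = 1 / 2 * ?uu"
    by (subst sphere_mean_add sphere_mean_cmult; (intro continuous_intros)?)+ (simp add: u2 u2')
  finally have nn: "?nn = ?uu / 2"
    by simp
  have "?uu + ?nn = sphere_mean (\<lambda>p. hopf_u p * cnj (hopf_u p) + hopf_n p * hopf_n p)"
    by (intro sphere_mean_add[symmetric] continuous_intros)
  also have "\<dots> = sphere_mean (\<lambda>_ :: real ^ 4. 1)"
    by (rule sphere_mean_cong) (auto intro!: continuous_intros simp: hopf_norm)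
  finally have "?uu + ?nn = 1"
    by (simp add: sphere_mean_const)
  with nn show "?uu = 2 / 3" "?nn = 1 / 3"
    by algebra+
qed

section \<open>The twirl\<close>

text \<open>Left unnormalised, hence unitary only for unit \<open>p\<close>, so that the entries are
  continuous on the whole space.\<close>

definition quaternion_matrix :: "real ^ 4 \<Rightarrow> 2 op"
  where "quaternion_matrix p = (\<chi> i j.
    if i = 0 then if j = 0 then upper p else lower p
    else if j = 0 then - cnj (lower p) else cnj (upper p))"

abbreviation bilateral :: "real ^ 4 \<Rightarrow> pair_op"
  where "bilateral p \<equiv> quaternion_matrix p \<otimes>\<^sub>o quaternion_matrix p"

lemma su2_eq: "su2 q = quaternion_matrix (sgn q)"
  by (simp add: su2_def quaternion_matrix_def upper_def lower_def sgn_div_norm vec_eq_iff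
      complex_eq_iff divide_inverse mult.commute)

lemma twirl_eq: "twirl \<rho> = sphere_mean (\<lambda>p. conj_by (bilateral p) \<rho>)"
  by (simp add: twirl_def sphere_mean_def ball_measure_def su2_eq)

lemma continuous_conj_by_bilateral: "continuous_on UNIV (\<lambda>p. conj_by (bilateral p) \<rho>)"
proof -
  have "continuous_on UNIV (\<lambda>p. quaternion_matrix p $ i $ j)" for i j
    unfolding quaternion_matrix_def
    by (cases "i = 0"; cases "j = 0") (auto intro!: continuous_intros)
  then have "continuous_on UNIV (\<lambda>p. \<chi> i j. conj_by (bilateral p) \<rho> $ i $ j)"
    unfolding conj_by_nth kron_op_def vec_lambda_beta
    by (intro continuous_on_vec_lambda continuous_on_sum continuous_on_mult continuous_on_cnj
        continuous_on_const)
  then show ?thesis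
    by simp
qed

text \<open>\<open>(odd_pop - odd_coh) / 2\<close> is the weight of the singlet, and
  \<open>(odd_pop + odd_coh) / 2\<close> that of the triplet state of weight zero.\<close>

definition odd_coh :: "pair_op \<Rightarrow> complex"
  where "odd_coh \<rho> = \<rho> $ (0, 1) $ (1, 0) + \<rho> $ (1, 0) $ (0, 1)"

text \<open>Twice these weights are quadratic forms in the sum and the difference of two rows of
  \<open>U\<close>.\<close>

lemma odd_conj_by:
  "odd_pop (conj_by U X) + odd_coh (conj_by U X) = (\<Sum>k\<in>UNIV. \<Sum>l\<in>UNIV. X $ k $ l *
    ((U $ (0, 1) $ k + U $ (1, 0) $ k) * cnj (U $ (0, 1) $ l + U $ (1, 0) $ l)))"
  "odd_pop (conj_by U X) - odd_coh (conj_by U X) = (\<Sum>k\<in>UNIV. \<Sum>l\<in>UNIV. X $ k $ l *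
    ((U $ (0, 1) $ k - U $ (1, 0) $ k) * cnj (U $ (0, 1) $ l - U $ (1, 0) $ l)))"
  unfolding odd_pop_def odd_coh_def conj_by_nth
  by (simp_all add: algebra_simps flip: sum.distrib sum_subtractf)

text \<open>The singlet row is multiplied by the determinant, which is the squared norm; the triplet
  row becomes the Hopf vector. The right-nested sum lets the mean be split term by term.\<close>

lemma odd_bilateral:
  "odd_pop (conj_by (bilateral p) X) - odd_coh (conj_by (bilateral p) X) =
    of_real ((norm p) ^ 4) * (odd_pop X - odd_coh X)"
  "odd_pop (conj_by (bilateral p) X) + odd_coh (conj_by (bilateral p) X) =
    (X $ (0, 0) $ (0, 0) + X $ (1, 1) $ (1, 1)) * (hopf_u p * cnj (hopf_u p))
    + ((odd_pop X + odd_coh X) * (hopf_n p * hopf_n p)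
    + (- X $ (0, 0) $ (1, 1) * (hopf_u p * hopf_u p)
    + (- X $ (1, 1) $ (0, 0) * (cnj (hopf_u p) * cnj (hopf_u p))
    + ((X $ (0, 1) $ (1, 1) + X $ (1, 0) $ (1, 1) - X $ (0, 0) $ (0, 1) - X $ (0, 0) $ (1, 0))
        * (hopf_u p * hopf_n p)
    + (X $ (1, 1) $ (0, 1) + X $ (1, 1) $ (1, 0) - X $ (0, 1) $ (0, 0) - X $ (1, 0) $ (0, 0))
        * (cnj (hopf_u p) * hopf_n p)))))"
proof -
  have minus: "bilateral p $ (0, 1) $ (0, 0) - bilateral p $ (1, 0) $ (0, 0) = 0"
    "bilateral p $ (0, 1) $ (1, 1) - bilateral p $ (1, 0) $ (1, 1) = 0"
    "bilateral p $ (0, 1) $ (0, 1) - bilateral p $ (1, 0) $ (0, 1) = of_real ((norm p)\<^sup>2)"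
    "bilateral p $ (0, 1) $ (1, 0) - bilateral p $ (1, 0) $ (1, 0) = - of_real ((norm p)\<^sup>2)"
    unfolding norm_upper_lower by (simp_all add: kron_op_def quaternion_matrix_def)
  show "odd_pop (conj_by (bilateral p) X) - odd_coh (conj_by (bilateral p) X) =
    of_real ((norm p) ^ 4) * (odd_pop X - odd_coh X)"
    unfolding odd_conj_by sum_two_bits minus
    by (simp add: odd_pop_def odd_coh_def algebra_simps power2_eq_square power4_eq_xxxx)
  have plus: "bilateral p $ (0, 1) $ (0, 0) + bilateral p $ (1, 0) $ (0, 0) = - hopf_u p"
    "bilateral p $ (0, 1) $ (1, 1) + bilateral p $ (1, 0) $ (1, 1) = cnj (hopf_u p)"
    "bilateral p $ (0, 1) $ (0, 1) + bilateral p $ (1, 0) $ (0, 1) = hopf_n p"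
    "bilateral p $ (0, 1) $ (1, 0) + bilateral p $ (1, 0) $ (1, 0) = hopf_n p"
    by (simp_all add: kron_op_def quaternion_matrix_def hopf_u_def hopf_n_def)
  have "cnj (hopf_n p) = hopf_n p"
    by (simp add: hopf_n_def mult.commute)
  then show "odd_pop (conj_by (bilateral p) X) + odd_coh (conj_by (bilateral p) X) =
    (X $ (0, 0) $ (0, 0) + X $ (1, 1) $ (1, 1)) * (hopf_u p * cnj (hopf_u p))
    + ((odd_pop X + odd_coh X) * (hopf_n p * hopf_n p)
    + (- X $ (0, 0) $ (1, 1) * (hopf_u p * hopf_u p)
    + (- X $ (1, 1) $ (0, 0) * (cnj (hopf_u p) * cnj (hopf_u p))
    + ((X $ (0, 1) $ (1, 1) + X $ (1, 0) $ (1, 1) - X $ (0, 0) $ (0, 1) - X $ (0, 0) $ (1, 0))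
        * (hopf_u p * hopf_n p)
    + (X $ (1, 1) $ (0, 1) + X $ (1, 1) $ (1, 0) - X $ (0, 1) $ (0, 0) - X $ (1, 0) $ (0, 0))
        * (cnj (hopf_u p) * hopf_n p)))))"
    unfolding odd_conj_by sum_two_bits plus
    by (simp add: odd_pop_def odd_coh_def algebra_simps)
qed

text \<open>The Gram matrix of a Kronecker product factorises, so orthonormal columns pass from
  \<open>quaternion_matrix p\<close> to \<open>bilateral p\<close>.\<close>

lemma trace_bilateral:
  assumes "norm p = 1"
  shows "trace (conj_by (bilateral p) X) = trace X"
proof -
  have one: "upper p * cnj (upper p) + lower p * cnj (lower p) = 1"
    using norm_upper_lower[of p] assms by simp
  have gram: "(\<Sum>i\<in>UNIV. quaternion_matrix p $ i $ k * cnj (quaternion_matrix p $ i $ l)) =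
      (if k = l then 1 else 0)" for k l
    using exhaust_2[of k] exhaust_2[of l] one
    by (auto simp: sum_bit quaternion_matrix_def mult.commute add.commute)
  have "(\<Sum>i\<in>UNIV. bilateral p $ i $ k * cnj (bilateral p $ i $ l)) =
      (\<Sum>i\<in>UNIV. quaternion_matrix p $ i $ fst k * cnj (quaternion_matrix p $ i $ fst l))
    * (\<Sum>i\<in>UNIV. quaternion_matrix p $ i $ snd k * cnj (quaternion_matrix p $ i $ snd l))" for k l
    by (simp add: sum_two_bits sum_bit kron_op_def algebra_simps)
  then have unitary: "(\<Sum>i\<in>UNIV. bilateral p $ i $ k * cnj (bilateral p $ i $ l)) =
      (if k = l then 1 else 0)" for k l
    by (simp add: gram prod_eq_iff)
  have "trace (conj_by (bilateral p) X) = (\<Sum>k\<in>UNIV. \<Sum>l\<in>UNIV. \<Sum>i\<in>UNIV.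
      X $ k $ l * (bilateral p $ i $ k * cnj (bilateral p $ i $ l)))"
    unfolding trace_def conj_by_nth
    by (subst sum.swap, rule sum.cong[OF refl], subst sum.swap) (simp add: mult_ac)
  also have "\<dots> = (\<Sum>k\<in>UNIV. \<Sum>l\<in>UNIV. if l = k then X $ k $ l else 0)"
    by (intro sum.cong refl) (simp add: unitary flip: sum_distrib_left)
  finally show ?thesis
    by (simp add: trace_def)
qed

text \<open>Trace and singlet weight are constant on the sphere. By the Hopf moments, the triplet
  state of weight zero receives a third of what remains.\<close>

lemma twirl_components:
  "trace (twirl X) = trace X"
  "odd_pop (twirl X) - odd_coh (twirl X) = odd_pop X - odd_coh X"
  "odd_pop (twirl X) + odd_coh (twirl X) = (2 * trace X - (odd_pop X - odd_coh X)) / 3"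
proof -
  note lin = sphere_mean_linear[OF _ continuous_conj_by_bilateral[of X], folded twirl_eq]
  have cont: "continuous_on UNIV (\<lambda>p. L (conj_by (bilateral p) X))" if "linear L"
    for L :: "pair_op \<Rightarrow> complex"
    using that by (intro linear_continuous_on_compose[OF continuous_conj_by_bilateral])
  have linear: "linear (trace :: pair_op \<Rightarrow> complex)" "linear (\<lambda>X. odd_pop X - odd_coh X)"
    "linear (\<lambda>X. odd_pop X + odd_coh X)"
    by (auto intro!: linearI simp: trace_pair even_pop_def odd_pop_def odd_coh_def algebra_simps)
  have "trace (twirl X) = sphere_mean (\<lambda>p. trace (conj_by (bilateral p) X))"
    by (rule lin) (rule linear)
  also have "\<dots> = sphere_mean (\<lambda>_ :: real ^ 4. trace X)"
    by (intro sphere_mean_cong trace_bilateral cont linear continuous_on_const)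
  finally show "trace (twirl X) = trace X"
    by (simp add: sphere_mean_const)
  have "odd_pop (twirl X) - odd_coh (twirl X) =
      sphere_mean (\<lambda>p. odd_pop (conj_by (bilateral p) X) - odd_coh (conj_by (bilateral p) X))"
    by (rule lin) (rule linear)
  also have "\<dots> = sphere_mean (\<lambda>_ :: real ^ 4. odd_pop X - odd_coh X)"
    by (intro sphere_mean_cong cont[OF linear(2)] continuous_on_const) (simp add: odd_bilateral)
  finally show "odd_pop (twirl X) - odd_coh (twirl X) = odd_pop X - odd_coh X"
    by (simp add: sphere_mean_const)
  have "odd_pop (twirl X) + odd_coh (twirl X) =
      sphere_mean (\<lambda>p. odd_pop (conj_by (bilateral p) X) + odd_coh (conj_by (bilateral p) X))"
    by (rule lin) (rule linear)
  also have "\<dots> = (X $ (0, 0) $ (0, 0) + X $ (1, 1) $ (1, 1)) * (2 / 3)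
      + (odd_pop X + odd_coh X) * (1 / 3)"
    unfolding odd_bilateral
    by (subst sphere_mean_add; (intro continuous_intros)?)+
      (simp only: sphere_mean_cmult hopf_moments, simp)
  also have "\<dots> = (2 * trace X - (odd_pop X - odd_coh X)) / 3"
    by (simp add: trace_pair even_pop_def field_simps)
  finally show "odd_pop (twirl X) + odd_coh (twirl X) = (2 * trace X - (odd_pop X - odd_coh X)) / 3" .
qed

section \<open>The change of frame and a full round of the earlier algorithm\<close>

lemma unilateral_sigma_y_nth:
  "unilateral_sigma_y \<rho> $ (a, b) $ (c, d) =
    (if b = d then 1 else - 1) * \<rho> $ (a, b + 1) $ (c, d + 1)"
proof -
  have "sigma_y $ x $ y = (if y = x + 1 then if x = 0 then - \<i> else \<i> else 0)" for x y
    using exhaust_2[of x] exhaust_2[of y]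
    by (auto simp: sigma_y_def ketbra_def ket_def axis_def)
  then have entry: "(mat 1 \<otimes>\<^sub>o sigma_y) $ (x, y) $ k =
      (if k = (x, y + 1) then if y = 0 then - \<i> else \<i> else 0)" for x y k
    by (cases k) (simp add: kron_op_def mat_def)
  have if_mult: "(if P then z else 0) * w = (if P then z * w else 0)"
    "w * cnj (if P then z else 0) = (if P then w * cnj z else 0)" for P and w z :: complex
    by simp_all
  \<comment> \<open>The two imaginary factors multiply to 1 if \<open>b = d\<close> and to -1
    otherwise.\<close>
  have "unilateral_sigma_y \<rho> $ (a, b) $ (c, d) = (if b = 0 then - \<i> else \<i>) *
      \<rho> $ (a, b + 1) $ (c, d + 1) * cnj (if d = 0 then - \<i> else \<i>)"
    unfolding unilateral_sigma_y_def conj_by_nth entry if_mult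
    by (simp only: sum.delta finite UNIV_I if_True)
  moreover have "x = 0 \<or> x = 1" for x :: 2
    using UNIV_bit by auto
  note this[of b] this[of d]
  ultimately show ?thesis
    by auto
qed

text \<open>Flipping the bit of B exchanges the parities, and only coherences change sign; so the
  weights of \<open>phi_plus\<close> and the singlet change places.\<close>

lemma unilateral_sigma_y_components:
  "even_pop (unilateral_sigma_y \<rho>) = odd_pop \<rho>" "odd_pop (unilateral_sigma_y \<rho>) = even_pop \<rho>"
  "even_coh (unilateral_sigma_y \<rho>) = - odd_coh \<rho>" "odd_coh (unilateral_sigma_y \<rho>) = - even_coh \<rho>"
  by (simp_all add: even_pop_def odd_pop_def even_coh_def odd_coh_def unilateral_sigma_y_nth)

text \<open>After the twirl, the components that enter the CNOT depend on \<open>F\<close> and the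
  trace alone, so these two are all that the induction carries.\<close>

lemma bbpssw_round_components:
  assumes fid: "even_pop \<rho> + even_coh \<rho> = of_real (2 * F)" and tr: "trace \<rho> = 1"
  shows "even_pop (bbpssw_round \<rho>) + even_coh (bbpssw_round \<rho>) = of_real (2 * bbpssw_map F)"
    "trace (bbpssw_round \<rho>) = 1"
proof -
  define X where "X = unilateral_sigma_y \<rho>"
  define \<sigma> where "\<sigma> = unilateral_sigma_y (twirl X)"
  have X: "odd_pop X - odd_coh X = of_real (2 * F)" "trace X = 1"
    using fid tr by (simp_all add: X_def trace_pair unilateral_sigma_y_components add.commute)
  have sum: "odd_pop (twirl X) + odd_coh (twirl X) = of_real (2 * (1 - F) / 3)"
    and diff: "odd_pop (twirl X) - odd_coh (twirl X) = of_real (2 * F)"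
    unfolding twirl_components X by simp_all
  \<comment> \<open>The Bell weights are now \<open>F\<close> for \<open>phi_plus\<close> and
    \<open>(1 - F) / 3\<close> for each other state; \<open>P\<close> and \<open>Q\<close> are the
    even and odd sums, \<open>Z\<close> the even difference.\<close>
  define P where "P = F + (1 - F) / 3"
  define Z where "Z = F - (1 - F) / 3"
  define Q where "Q = 2 * (1 - F) / 3"
  have \<sigma>: "even_pop \<sigma> = of_real P" "even_coh \<sigma> = of_real Z"
  proof -
    have "x = of_real ((a + b) / 2)" "- y = of_real ((b - a) / 2)"
      if "x + y = of_real a" "x - y = of_real b" for x y :: complex and a b
      by (simp_all flip: that)
    note twirled = this[OF sum diff]
    have "(2 * (1 - F) / 3 + 2 * F) / 2 = P" "(2 * F - 2 * (1 - F) / 3) / 2 = Z"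
      by (simp_all add: P_def Z_def field_simps)
    then show "even_pop \<sigma> = of_real P" "even_coh \<sigma> = of_real Z"
      by (simp_all only: \<sigma>_def unilateral_sigma_y_components twirled)
  qed
  have "trace (twirl X) = 1"
    by (simp add: twirl_components X)
  then have "even_pop \<sigma> + odd_pop \<sigma> = 1"
    by (simp add: \<sigma>_def unilateral_sigma_y_components trace_pair add.commute)
  then have "odd_pop \<sigma> = 1 - of_real P"
    unfolding \<sigma> by (simp add: eq_diff_eq add.commute)
  then have "odd_pop \<sigma> = of_real Q"
    by (simp add: P_def Q_def field_simps)
  note kept = kept_state_components[OF \<sigma> this]
  have round: "bbpssw_round \<rho> = kept_state \<sigma>"
    by (simp add: bbpssw_round_def \<sigma>_def X_def)
  have N: "P\<^sup>2 + Q\<^sup>2 = F\<^sup>2 + 2 / 3 * F * (1 - F) + 5 / 9 * (1 - F)\<^sup>2"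
    by (simp add: P_def Q_def power2_eq_square field_simps)
  have "P\<^sup>2 + Z\<^sup>2 = 2 * (F\<^sup>2 + 1 / 9 * (1 - F)\<^sup>2)"
    by (simp add: P_def Z_def power2_eq_square field_simps)
  then have "P\<^sup>2 / (P\<^sup>2 + Q\<^sup>2) + Z\<^sup>2 / (P\<^sup>2 + Q\<^sup>2) = 2 * bbpssw_map F"
    unfolding bbpssw_map_def N by (simp flip: add_divide_distrib)
  then show "even_pop (bbpssw_round \<rho>) + even_coh (bbpssw_round \<rho>) = of_real (2 * bbpssw_map F)"
    unfolding round kept by (metis of_real_add)
  have "P\<^sup>2 / (P\<^sup>2 + Q\<^sup>2) + Q\<^sup>2 / (P\<^sup>2 + Q\<^sup>2) = 1"
    using bbpssw_denominator_pos[of F] by (simp add: N flip: add_divide_distrib)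
  then show "trace (bbpssw_round \<rho>) = 1"
    unfolding round trace_pair kept by (metis of_real_add of_real_1)
qed

lemma fidelity_bbpssw_Suc:
  assumes "density_operator \<rho>"
  shows "fidelity (bbpssw_state \<rho> (Suc k)) = bbpssw_map (fidelity (bbpssw_state \<rho> k))"
proof -
  have "\<exists>F. even_pop (bbpssw_state \<rho> k) + even_coh (bbpssw_state \<rho> k) = of_real (2 * F) \<and>
    trace (bbpssw_state \<rho> k) = 1"
  proof (induction k)
    case 0
    have "dagger \<rho> $ i $ j = \<rho> $ i $ j" for i j
      using assms by (simp add: density_operator_def)
    then have "cnj (\<rho> $ j $ i) = \<rho> $ i $ j" for i j
      by (simp add: dagger_def)
    \<comment> \<open>Hermiticity makes the quadratic form at \<open>phi_plus\<close> real, which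
      starts the induction.\<close>
    then have "cnj (even_pop \<rho> + even_coh \<rho>) = even_pop \<rho> + even_coh \<rho>"
      unfolding even_pop_def even_coh_def complex_cnj_add by simp
    moreover have "\<exists>F. x = of_real (2 * F)" if "cnj x = x" for x
      using that by (intro exI[of _ "Re x / 2"]) (simp add: complex_eq_iff)
    ultimately have "\<exists>F. even_pop \<rho> + even_coh \<rho> = of_real (2 * F)"
      by blast
    moreover have "bbpssw_state \<rho> 0 = \<rho>" "trace \<rho> = 1"
      using assms by (simp_all add: bbpssw_state_def density_operator_def)
    ultimately show ?case
      by (simp only:) blast
  next
    case (Suc k)
    then obtain F where F: "even_pop (bbpssw_state \<rho> k) + even_coh (bbpssw_state \<rho> k) = of_real (2 * F)"
      "trace (bbpssw_state \<rho> k) = 1"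
      by blast
    have "bbpssw_state \<rho> (Suc k) = bbpssw_round (bbpssw_state \<rho> k)"
      by (simp add: bbpssw_state_def)
    then show ?case
      using bbpssw_round_components[OF F] by metis
  qed
  then obtain F where F: "even_pop (bbpssw_state \<rho> k) + even_coh (bbpssw_state \<rho> k) = of_real (2 * F)"
    "trace (bbpssw_state \<rho> k) = 1"
    by blast
  have "bbpssw_state \<rho> (Suc k) = bbpssw_round (bbpssw_state \<rho> k)"
    by (simp add: bbpssw_state_def)
  then show ?thesis
    unfolding fidelity_eq F(1) by (simp only: bbpssw_round_components(1)[OF F]) simp
qed

theorem mainTheorem5:
  shows
    "(\<forall>(\<rho> :: pair_op) (F :: nat \<Rightarrow> real).
        density_operator \<rho> \<and> F = (\<lambda>k. fidelity (bbpssw_state \<rho> k)) \<longrightarrow>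
        (\<forall>k. F (Suc k) = ((F k)\<^sup>2 + 1 / 9 * (1 - F k)\<^sup>2) /
                ((F k)\<^sup>2 + 2 / 3 * F k * (1 - F k) + 5 / 9 * (1 - F k)\<^sup>2)) \<and>
        (1 / 2 < F 0 \<and> F 0 < 1 \<longrightarrow>
          (\<lambda>k. (1 - F (Suc k)) / (1 - F k)) \<longlonglongrightarrow> 2 / 3 \<and>
          converges_linearly F 1 (2 / 3)))
     \<and>
     (\<forall>(a :: complex ^ 2) (a' :: complex ^ 2) (b :: complex ^ 2) (b' :: complex ^ 2)
         (\<alpha> :: real) (R :: complex) (F :: nat \<Rightarrow> real).
        qubit_basis a a' \<and> qubit_basis b b' \<and> 0 \<le> \<alpha> \<and> \<alpha> < 2 * pi \<and> cmod R \<le> 1 \<and>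
        F = (\<lambda>k. fidelity (proposed_state a a' b b' \<alpha> R k)) \<longrightarrow>
        (\<forall>k. F (Suc k) = (F k)\<^sup>2 / ((F k)\<^sup>2 + (1 - F k)\<^sup>2)) \<and>
        (1 / 2 < F 0 \<and> F 0 < 1 \<longrightarrow>
          (\<lambda>k. (1 - F (Suc k)) / (1 - F k)) \<longlonglongrightarrow> 0 \<and>
          (\<lambda>k. (1 - F (Suc k)) / (1 - F k)\<^sup>2) \<longlonglongrightarrow> 1 \<and>
          converges_quadratically F 1))"
proof (intro conjI allI impI; elim conjE)
  fix \<rho> :: pair_op and F :: "nat \<Rightarrow> real"
  assume \<rho>: "density_operator \<rho>" and F: "F = (\<lambda>k. fidelity (bbpssw_state \<rho> k))"
  have step: "F (Suc k) = bbpssw_map (F k)" for k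
    unfolding F using \<rho> by (rule fidelity_bbpssw_Suc)
  show "F (Suc k) = ((F k)\<^sup>2 + 1 / 9 * (1 - F k)\<^sup>2) /
      ((F k)\<^sup>2 + 2 / 3 * F k * (1 - F k) + 5 / 9 * (1 - F k)\<^sup>2)" for k
    using step unfolding bbpssw_map_def .
  assume "1 / 2 < F 0" "F 0 < 1"
  note lim = bbpssw_iterates[OF step this]
  show "(\<lambda>k. (1 - F (Suc k)) / (1 - F k)) \<longlonglongrightarrow> 2 / 3" "converges_linearly F 1 (2 / 3)"
    by (fact lim)+
next
  fix a a' b b' :: "complex ^ 2" and \<alpha> :: real and R :: complex and F :: "nat \<Rightarrow> real"
  assume basis: "qubit_basis a a'" "qubit_basis b b'"
    and F: "F = (\<lambda>k. fidelity (proposed_state a a' b b' \<alpha> R k))"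
  have step: "F (Suc k) = proposed_map (F k)" for k
    unfolding F using basis by (rule fidelity_proposed_Suc)
  show "F (Suc k) = (F k)\<^sup>2 / ((F k)\<^sup>2 + (1 - F k)\<^sup>2)" for k
    using step unfolding proposed_map_def .
  assume "1 / 2 < F 0" "F 0 < 1"
  note lim = proposed_iterates[OF step this]
  show "(\<lambda>k. (1 - F (Suc k)) / (1 - F k)) \<longlonglongrightarrow> 0"
    "(\<lambda>k. (1 - F (Suc k)) / (1 - F k)\<^sup>2) \<longlonglongrightarrow> 1" "converges_quadratically F 1"
    by (fact lim)+
qed

end
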